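(* There do not exist integers $a, b, x$ and primes $p, q$ such that \[ x^3 - 1 = p^2 a^3 \qquad\text{and}\qquad x^3 + 1 = q^2 b^3 . \] Equivalently, there are no three consecutive powerful numbers of the form $x^3-1 = p^2a^3$, $x^3$, $x^3+1 = q^2 b^3$ with $p,q$ prime and $a,b,x$ integers.
   Context: A positive integer is called powerful if every prime factor of it appears with exponent at least two. *)

theory Defs
  imports Main "HOL-Computational_Algebra.Primes"
begin

end

theory Submission
  imports Defs "HOL-Computational_Algebra.Nth_Powers"
begin

text \<open>
  The symmetry \<open>x \<mapsto> -x\<close> swaps the two equations, so \<open>x \<equiv> 0\<close> or \<open>x \<equiv> 1 (mod 3)\<close> may be assumed.
  If \<open>3 dvd x\<close>, both factorizations \<open>x\<^sup>3 \<mp> 1 = (x \<mp> 1) (x\<^sup>2 \<plusminus> x + 1)\<close> are coprime, so one factor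
  of each is a cube, and each of the four combinations is excluded by squeezing between
  consecutive cubes.

  If \<open>x = 3 m + 1\<close>, a \<open>3\<close>-adic analysis shows that either \<open>3 m\<^sup>2 + 3 m + 1 = (m + 1)\<^sup>3 - m\<^sup>3\<close> is a
  cube, or \<open>x - 1 = 9 s\<^sup>3\<close> and \<open>x\<^sup>2 - x + 1\<close> is a cube. Both lead to \<open>u v (u - v) = d s\<^sup>3\<close> with
  coprime \<open>u, v\<close> and \<open>d \<in> {1, 3}\<close>, equivalently to \<open>a\<^sup>3 + b\<^sup>3 + d c\<^sup>3 = 0\<close>. Infinite descent forces
  \<open>s = 0\<close>: after dividing \<open>a + b \<omega>\<close> by \<open>1 - \<omega>\<close> in \<open>\<int>[\<omega>]\<close>, the quotient is a cube
  \<open>(u + v \<omega>)\<^sup>3\<close>, whose \<open>\<omega>\<close>-coefficient is \<open>3 u v (u - v)\<close>, and this gives a smaller solution of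
  the same equation.
\<close>

subsection \<open>Eisenstein integers\<close>

text \<open>\<open>Eis a b\<close> stands for \<open>a + b \<omega>\<close>, where \<open>\<omega>\<^sup>2 + \<omega> + 1 = 0\<close>.\<close>

datatype eis = Eis (rat_part: int) (omega_part: int)

instantiation eis :: comm_ring_1
begin
definition "0 = Eis 0 0"
definition "1 = Eis 1 0"
definition "x + y = Eis (rat_part x + rat_part y) (omega_part x + omega_part y)"
definition "- x = Eis (- rat_part x) (- omega_part x)"
definition "x - y = Eis (rat_part x - rat_part y) (omega_part x - omega_part y)"
definition "x * y = Eis (rat_part x * rat_part y - omega_part x * omega_part y)
  (rat_part x * omega_part y + omega_part x * rat_part y - omega_part x * omega_part y)"
instance
  by standard (auto simp: zero_eis_def one_eis_def plus_eis_def uminus_eis_def minus_eis_def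
      times_eis_def algebra_simps)
end

lemma Eis_arith [simp]:
  "Eis a b + Eis c d = Eis (a + c) (b + d)"
  "Eis a b - Eis c d = Eis (a - c) (b - d)"
  "- Eis a b = Eis (- a) (- b)"
  "Eis a b * Eis c d = Eis (a * c - b * d) (a * d + b * c - b * d)"
  by (simp_all add: plus_eis_def minus_eis_def uminus_eis_def times_eis_def)

lemma of_int_eis: "of_int n = Eis n 0"
proof (induction n rule: int_induct[where k = 0])
  case base then show ?case by (simp add: zero_eis_def)
next
  case (step1 i) then show ?case by (simp add: one_eis_def)
next
  case (step2 i) then show ?case by (simp add: one_eis_def)
qed

section \<open>Norm, conjugation and Euclidean division in the Eisenstein integers\<close>

fun eis_norm :: "eis \<Rightarrow> int" where
  "eis_norm (Eis a b) = a\<^sup>2 - a * b + b\<^sup>2"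

fun eis_cnj :: "eis \<Rightarrow> eis" where
  "eis_cnj (Eis a b) = Eis (a - b) (- b)"

lemma four_eis_norm: "4 * eis_norm (Eis a b) = (2 * a - b)\<^sup>2 + 3 * b\<^sup>2"
  by (simp add: power2_eq_square algebra_simps)

lemma eis_norm_nonneg: "eis_norm x \<ge> 0"
proof (cases x)
  case (Eis a b)
  then show ?thesis
    using four_eis_norm[of a b] zero_le_power2[of "2 * a - b"] zero_le_power2[of b]
    unfolding Eis by linarith
qed

lemma eis_norm_eq_0_iff: "eis_norm x = 0 \<longleftrightarrow> x = 0"
proof (cases x)
  case (Eis a b)
  have "a = 0 \<and> b = 0" if "eis_norm x = 0"
  proof -
    have "(2 * a - b)\<^sup>2 + 3 * b\<^sup>2 = 0"
      using four_eis_norm[of a b] that Eis by simp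
    then have "b\<^sup>2 = 0" "(2 * a - b)\<^sup>2 = 0"
      using zero_le_power2[of "2 * a - b"] zero_le_power2[of b] by linarith+
    then show ?thesis by simp
  qed
  then show ?thesis using Eis by (auto simp: zero_eis_def)
qed

lemma eis_norm_mult: "eis_norm (x * y) = eis_norm x * eis_norm y"
  by (cases x; cases y) (simp add: power2_eq_square algebra_simps)

lemma eis_norm_cnj: "eis_norm (eis_cnj x) = eis_norm x"
  by (cases x) (simp add: power2_eq_square algebra_simps)

lemma mult_eis_cnj: "x * eis_cnj x = of_int (eis_norm x)"
  by (cases x) (simp add: of_int_eis power2_eq_square algebra_simps)

lemma eis_norm_of_int: "eis_norm (of_int n) = n\<^sup>2"
  by (simp add: of_int_eis)

lemma eis_mult_eq_0D: "(x :: eis) * y = 0 \<Longrightarrow> x = 0 \<or> y = 0"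
  by (metis eis_norm_eq_0_iff eis_norm_mult mult_eq_0_iff)

instance eis :: idom
  by standard (use eis_mult_eq_0D in blast)

lemma nearest_multiple_int:
  fixes n a :: int
  assumes "n > 0"
  obtains q where "\<bar>2 * (a - n * q)\<bar> \<le> n"
proof -
  \<comment> \<open>This is the floor of a/n + 1/2, so \<open>n * q\<close> is a multiple of
    \<open>n\<close> nearest to \<open>a\<close>.\<close>
  define q where "q = (2 * a + n) div (2 * n)"
  have eq: "2 * a + n = 2 * n * q + (2 * a + n) mod (2 * n)"
    unfolding q_def by (metis mult_div_mod_eq)
  have "0 \<le> (2 * a + n) mod (2 * n)" "(2 * a + n) mod (2 * n) < 2 * n"
    using assms by simp_all
  with eq have "\<bar>2 * (a - n * q)\<bar> \<le> n"
    by (simp add: algebra_simps)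
  then show ?thesis by (rule that)
qed

text \<open>The exact quotient is \<open>x * eis_cnj y\<close> over the norm n of y. Rounding both
  coordinates leaves an error \<open>Eis s t\<close> with |s|, |t| at most n/2, whose norm is at
  most 3/4 of n squared.\<close>

lemma eis_division:
  assumes "y \<noteq> 0"
  obtains q where "eis_norm (x - y * q) < eis_norm y"
proof -
  define n where "n = eis_norm y"
  have n: "n > 0"
    using assms eis_norm_nonneg[of y] eis_norm_eq_0_iff[of y] by (simp add: n_def)
  obtain a b where ab: "x * eis_cnj y = Eis a b" by (cases "x * eis_cnj y")
  obtain k where k: "\<bar>2 * (a - n * k)\<bar> \<le> n" using nearest_multiple_int[OF n] .
  obtain l where l: "\<bar>2 * (b - n * l)\<bar> \<le> n" using nearest_multiple_int[OF n] .
  define s t where "s = a - n * k" and "t = b - n * l"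
  have "(x - y * Eis k l) * eis_cnj y = x * eis_cnj y - (y * eis_cnj y) * Eis k l"
    by (simp add: algebra_simps)
  also have "\<dots> = Eis s t"
    by (simp add: ab mult_eis_cnj of_int_eis s_def t_def n_def)
  finally have "eis_norm (x - y * Eis k l) * n = s\<^sup>2 - s * t + t\<^sup>2"
    by (metis eis_norm.simps eis_norm_cnj eis_norm_mult n_def)
  moreover have "4 * (s\<^sup>2 - s * t + t\<^sup>2) \<le> 3 * n\<^sup>2"
  proof -
    have "(2 * s)\<^sup>2 \<le> n\<^sup>2" "(2 * t)\<^sup>2 \<le> n\<^sup>2"
      using k l n unfolding abs_le_square_iff[symmetric] s_def t_def by linarith+
    moreover have "\<bar>(2 * s) * (2 * t)\<bar> \<le> n * n"
      unfolding abs_mult[of "2 * s" "2 * t"]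
      by (rule mult_mono[OF k[folded s_def] l[folded t_def]]) (use n in simp_all)
    ultimately show ?thesis by (simp add: power2_eq_square)
  qed
  ultimately have "4 * (eis_norm (x - y * Eis k l) * n) \<le> 3 * n\<^sup>2" by simp
  also have "\<dots> < 4 * (n * n)" using n by (simp add: power2_eq_square)
  finally have "eis_norm (x - y * Eis k l) < n" using n by simp
  then show ?thesis using that n_def by blast
qed

text \<open>Euclid's algorithm, as strong induction on the norm of y: the pair (x, y) passes to (y,
  x - y q).\<close>

lemma eis_bezout:
  obtains g u v where "g = x * u + y * v" "g dvd x" "g dvd (y :: eis)"
proof -
  have "\<exists>g u v. g = x * u + y * v \<and> g dvd x \<and> g dvd y"
  proof (induction "nat (eis_norm y)" arbitrary: x y rule: less_induct)
    case less
    show ?case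
    proof (cases "y = 0")
      case True
      then show ?thesis by (intro exI[of _ x] exI[of _ 1]) simp
    next
      case False
      then obtain q where q: "eis_norm (x - y * q) < eis_norm y" by (rule eis_division)
      then have "nat (eis_norm (x - y * q)) < nat (eis_norm y)"
        using eis_norm_nonneg[of "x - y * q"] by linarith
      then obtain g u v where g: "g = y * u + (x - y * q) * v" "g dvd y" "g dvd x - y * q"
        using less by blast
      from g(2,3) have "g dvd x" by (metis dvd_add dvd_mult2 diff_add_cancel)
      moreover have "g = x * v + y * (u - q * v)" using g(1) by (simp add: algebra_simps)
      ultimately show ?thesis using g(2) by blast
    qed
  qed
  then show ?thesis using that by blast
qed

section \<open>Units, and coprime factors of a cube\<close>

lemma eis_norm_unit_cases:
  assumes "eis_norm e = 1"
  shows "e \<in> {1, - 1, Eis 0 1, - Eis 0 1, Eis (- 1) (- 1), - Eis (- 1) (- 1)}"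
proof (cases e)
  case (Eis a b)
  have eq: "a\<^sup>2 - a * b + b\<^sup>2 = 1" using assms Eis by simp
  \<comment> \<open>Completing the square in either variable bounds both coordinates, leaving a
    finite check.\<close>
  have "(2 * a - b)\<^sup>2 + 3 * b\<^sup>2 = 4" "(2 * b - a)\<^sup>2 + 3 * a\<^sup>2 = 4"
    using eq by (simp_all add: power2_eq_square algebra_simps)
  then have "a\<^sup>2 < 4" "b\<^sup>2 < 4"
    using zero_le_power2[of "2 * a - b"] zero_le_power2[of "2 * b - a"]
      zero_le_power2[of a] zero_le_power2[of b]
    by linarith+
  then have "\<bar>a\<bar> < 2" "\<bar>b\<bar> < 2"
    using power2_less_imp_less[of "\<bar>a\<bar>" 2] power2_less_imp_less[of "\<bar>b\<bar>" 2] by simp_all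
  then have "a = -1 \<or> a = 0 \<or> a = 1" "b = -1 \<or> b = 0 \<or> b = 1" by linarith+
  then show ?thesis using eq Eis by (auto simp: one_eis_def)
qed

text \<open>If \<open>\<pi>\<close> generates the ideal \<open>(\<alpha>, c)\<close>, then \<open>(\<pi>)\<^sup>3 = \<alpha> (\<alpha>\<^sup>2, \<alpha> c, c\<^sup>2, \<beta>) = (\<alpha>)\<close>,
  so no unique factorization is needed.\<close>

lemma eis_coprime_mult_eq_cube:
  fixes \<alpha> \<beta> c :: eis
  assumes "\<alpha> * \<beta> = c ^ 3" and "\<alpha> * k + \<beta> * l = 1" and "\<alpha> \<noteq> 0"
  obtains \<epsilon> \<pi> where "eis_norm \<epsilon> = 1" "\<alpha> = \<epsilon> * \<pi> ^ 3"
proof -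
  obtain \<pi> x y where \<pi>: "\<pi> = \<alpha> * x + c * y" "\<pi> dvd \<alpha>" "\<pi> dvd c" by (rule eis_bezout)
  have "\<pi> ^ 3 = \<alpha> * (\<alpha>\<^sup>2 * x ^ 3 + 3 * \<alpha> * c * x\<^sup>2 * y + 3 * c\<^sup>2 * x * y\<^sup>2) + c ^ 3 * y ^ 3"
    unfolding \<pi>(1) by (simp add: power2_eq_square power3_eq_cube algebra_simps)
  also have "\<dots> = \<alpha> * (\<alpha>\<^sup>2 * x ^ 3 + 3 * \<alpha> * c * x\<^sup>2 * y + 3 * c\<^sup>2 * x * y\<^sup>2 + \<beta> * y ^ 3)"
    by (simp add: assms(1)[symmetric] algebra_simps)
  finally obtain z where z: "\<pi> ^ 3 = \<alpha> * z" by blast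
  have "\<pi> ^ 3 dvd \<alpha> ^ 3" "\<pi> ^ 3 dvd c ^ 3" using \<pi> by (simp_all add: dvd_power_same)
  \<comment> \<open>This is the expansion of \<alpha> (\<alpha> k + \<beta> l)^2, which equals
    \<alpha>, with \<alpha> \<beta> replaced by c^3.\<close>
  then have "\<pi> ^ 3 dvd \<alpha> ^ 3 * k\<^sup>2 + c ^ 3 * (2 * \<alpha> * k * l + \<beta> * l\<^sup>2)" by (simp add: dvd_add)
  also have "\<dots> = \<alpha> * (\<alpha> * k + \<beta> * l)\<^sup>2"
    unfolding assms(1)[symmetric] by (simp add: power2_eq_square power3_eq_cube algebra_simps)
  finally obtain e where e: "\<alpha> = e * \<pi> ^ 3"
    using assms(2) by (metis dvdE mult.commute mult_1_right power_one)
  with z have "\<alpha> * (e * z) = \<alpha> * 1" by (metis mult.assoc mult.commute mult_1_right)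
  then have "e * z = 1" using assms(3) by (simp only: mult_cancel_left) simp
  then have "eis_norm e * eis_norm z = 1"
    by (metis eis_norm_mult eis_norm_of_int of_int_1 power_one)
  then have "eis_norm e = 1" using eis_norm_nonneg[of e] by (simp add: zmult_eq_1_iff)
  with e show ?thesis using that by blast
qed

lemma eis_cube:
  "Eis u v ^ 3 = Eis (u ^ 3 + v ^ 3 - 3 * u * v\<^sup>2) (3 * u * v * (u - v))"
  by (simp add: power2_eq_square power3_eq_cube algebra_simps)

text \<open>The cube c^3 is the norm of a + b \<omega>. Being coprime to 3b, it makes a + b \<omega>
  coprime to its conjugate, so a + b \<omega> is a unit times a cube. Divisibility of b by 3 then
  restricts the unit to 1 or -1.\<close>

lemma norm_form_eq_cube:
  fixes a b c :: int
  assumes "coprime a b" and "3 dvd b" and "a\<^sup>2 - a * b + b\<^sup>2 = c ^ 3"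
  obtains u v where "b = 3 * u * v * (u - v)" "coprime u v"
proof -
  define \<alpha> \<beta> where "\<alpha> = Eis a b" and "\<beta> = Eis (a - b) (- b)"
  have a3: "\<not> 3 dvd a"
    using assms(1,2) coprime_common_divisor[of a b 3] by auto
  have "coprime (c ^ 3) b"
  proof -
    have "coprime (a\<^sup>2 + b * (b - a)) b" using assms(1)
      by (metis coprime_commute coprime_iff_gcd_eq_1 coprime_power_right_iff gcd_add_mult mult.commute add.commute)
    moreover have "a\<^sup>2 + b * (b - a) = c ^ 3" using assms(3) by (simp add: power2_eq_square algebra_simps)
    ultimately show ?thesis by simp
  qed
  moreover have "coprime (c ^ 3) 3"
  proof -
    have "\<not> 3 dvd c ^ 3"
    proof
      assume "3 dvd c ^ 3"
      moreover have "a\<^sup>2 = c ^ 3 + b * (a - b)"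
        using assms(3) by (simp add: power2_eq_square algebra_simps)
      ultimately have "3 dvd a\<^sup>2" using assms(2) by simp
      then show False using a3 by (simp add: prime_dvd_power_iff)
    qed
    then show ?thesis using prime_imp_coprime[of 3 "c ^ 3"] coprime_commute by auto
  qed
  ultimately have "coprime (c ^ 3) (3 * b)" by simp
  then obtain k l where kl: "k * c ^ 3 + l * (3 * b) = 1"
    by (metis bezout_int coprime_iff_gcd_eq_1)
  have "\<alpha> * \<beta> = Eis (c ^ 3) 0"
    using assms(3) by (simp add: \<alpha>_def \<beta>_def power2_eq_square algebra_simps)
  then have prod: "\<alpha> * \<beta> = of_int c ^ 3"
    by (metis of_int_eis of_int_power)
  \<comment> \<open>The coefficients come from \<alpha> - \<beta> = b (1 + 2 \<omega>) and (1 + 2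
    \<omega>)^2 = -3: multiplying the difference by -(1 + 2 \<omega>) gives 3b.\<close>
  have "\<alpha> * (of_int l * Eis (- 1) (- 2)) + \<beta> * (of_int k * \<alpha> + of_int l * Eis 1 2)
      = of_int k * (\<alpha> * \<beta>) + of_int l * (\<alpha> * Eis (- 1) (- 2) + \<beta> * Eis 1 2)"
    by (simp only: algebra_simps)
  also have "\<alpha> * Eis (- 1) (- 2) + \<beta> * Eis 1 2 = of_int (3 * b)"
    unfolding of_int_eis by (simp add: \<alpha>_def \<beta>_def)
  also have "of_int k * (\<alpha> * \<beta>) + of_int l * of_int (3 * b) = (of_int (k * c ^ 3 + l * (3 * b)) :: eis)"
    by (simp add: prod)
  finally have comb: "\<alpha> * (of_int l * Eis (- 1) (- 2)) + \<beta> * (of_int k * \<alpha> + of_int l * Eis 1 2) = 1"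
    by (simp only: kl of_int_1)
  have "\<alpha> \<noteq> 0" using a3 by (auto simp: \<alpha>_def zero_eis_def)
  then obtain \<epsilon> \<pi> where \<epsilon>: "eis_norm \<epsilon> = 1" "\<alpha> = \<epsilon> * \<pi> ^ 3"
    using eis_coprime_mult_eq_cube[OF prod comb] by blast
  \<comment> \<open>Signs are absorbed into the cube, leaving only the units 1, \<omega> and
    \<omega>^2 = -1 - \<omega>.\<close>
  have "(- 1) * \<rho> ^ 3 = (- \<rho>) ^ 3" "(- \<theta>) * \<rho> ^ 3 = \<theta> * (- \<rho>) ^ 3" for \<rho> \<theta> :: eis
    by simp_all
  then have "\<exists>\<rho>. \<alpha> = \<rho> ^ 3 \<or> \<alpha> = Eis 0 1 * \<rho> ^ 3 \<or> \<alpha> = Eis (- 1) (- 1) * \<rho> ^ 3"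
    using eis_norm_unit_cases[OF \<epsilon>(1)] \<epsilon>(2) by (metis empty_iff insert_iff mult_1_left)
  then obtain \<rho> where \<rho>: "\<alpha> = \<rho> ^ 3 \<or> \<alpha> = Eis 0 1 * \<rho> ^ 3 \<or> \<alpha> = Eis (- 1) (- 1) * \<rho> ^ 3" ..
  obtain u v where uv: "\<rho> = Eis u v" by (cases \<rho>)
  define A B where "A = u ^ 3 + v ^ 3 - 3 * u * v\<^sup>2" and "B = 3 * u * v * (u - v)"
  have cube: "\<rho> ^ 3 = Eis A B" by (simp add: uv eis_cube A_def B_def)
  have "3 dvd B" by (simp add: B_def)
  have "a = A \<and> b = B \<or> a = - B \<and> b = A - B \<or> a = B - A \<and> b = - A"
    using \<rho> unfolding \<alpha>_def cube by auto
  \<comment> \<open>For the units \<omega> and \<omega>^2, 3 dividing both B and b would force 3 to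
    divide a.\<close>
  then have ab: "a = A" "b = B"
    using \<open>3 dvd B\<close> assms(2) a3 by (auto simp: dvd_diff_left_iff dvd_diff_right_iff)
  have "coprime u v"
  proof (rule coprimeI)
    fix d assume d: "d dvd u" "d dvd v"
    then have "d dvd A" "d dvd B" by (auto simp: A_def B_def power2_eq_square power3_eq_cube)
    then show "is_unit d" using assms(1) ab coprime_common_divisor by blast
  qed
  then show ?thesis using that ab B_def by blast
qed

subsection \<open>Cubes of integers\<close>

lemma int_cube_less_iff: "(a::int) ^ 3 < b ^ 3 \<longleftrightarrow> a < b"
proof -
  have less: "x ^ 3 < y ^ 3" if "x < y" for x y :: int
  proof -
    \<comment> \<open>Four times (x + 1)^3 - x^3 equals 3 (2x + 1)^2 + 1.\<close>
    have "0 \<le> (2 * x + 1)\<^sup>2" by simp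
    then have "x ^ 3 < (x + 1) ^ 3"
      by (simp add: power2_eq_square power3_eq_cube algebra_simps)
    also have "\<dots> \<le> y ^ 3" using that by (intro power_mono_odd) auto
    finally show ?thesis .
  qed
  then show ?thesis by (metis less_asym linorder_less_linear)
qed

lemma int_cube_eq_iff: "(a::int) ^ 3 = b ^ 3 \<longleftrightarrow> a = b"
  by (metis int_cube_less_iff less_irrefl linorder_less_linear)

text \<open>Three residues from {1, -1} never sum to 0 mod 9, so in a vanishing sum of three cubes
  one base is a multiple of 3.\<close>

lemma int_cube_mod_9: "3 dvd x \<and> x ^ 3 mod 9 = 0 \<or> x ^ 3 mod 9 = 1 \<or> x ^ 3 mod 9 = (8::int)"
proof -
  define k r where "k = x div 3" and "r = x mod 3"
  have x: "x = 3 * k + r" by (simp add: k_def r_def)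
  have "x ^ 3 = r ^ 3 + 9 * (3 * k ^ 3 + 3 * k\<^sup>2 * r + k * r\<^sup>2)"
    by (simp add: x power2_eq_square power3_eq_cube algebra_simps)
  then have "x ^ 3 mod 9 = r ^ 3 mod 9" by (simp only: mod_mult_self2)
  moreover have "r = 0 \<or> r = 1 \<or> r = 2" unfolding r_def by presburger
  ultimately show ?thesis using x by auto
qed

lemma coprime_mult_eq_cube_int:
  fixes A B c :: int
  assumes "coprime A B" and "A * B = c ^ 3"
  obtains d e where "A = d ^ 3" "B = e ^ 3" "c = d * e"
proof -
  have cube: "\<exists>d. x = d ^ 3" if "is_nth_power 3 (nat \<bar>x\<bar>)" for x :: int
  proof -
    from that obtain n where "nat \<bar>x\<bar> = n ^ 3" by (auto simp: is_nth_power_def)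
    then have "\<bar>x\<bar> = int n ^ 3" by (metis abs_ge_zero int_nat_eq of_nat_power)
    then have "x = int n ^ 3 \<or> x = (- int n) ^ 3" by auto
    then show ?thesis by blast
  qed
  have "coprime (nat \<bar>A\<bar>) (nat \<bar>B\<bar>)" using assms(1) by (simp add: coprime_nat_abs_left_iff coprime_nat_abs_right_iff)
  moreover have "nat \<bar>A\<bar> * nat \<bar>B\<bar> = nat \<bar>c\<bar> ^ 3"
    using assms(2) by (metis abs_mult nat_abs_mult_distrib power_abs nat_power_eq abs_ge_zero)
  ultimately have "is_nth_power 3 (nat \<bar>A\<bar>)" "is_nth_power 3 (nat \<bar>B\<bar>)"
    by (metis is_nth_power_mult_coprime_nat_iff is_nth_power_nth_power)+
  then obtain d e where de: "A = d ^ 3" "B = e ^ 3" using cube by meson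
  then have "(d * e) ^ 3 = c ^ 3" using assms(2) by (simp add: power_mult_distrib)
  then have "c = d * e" by (simp only: int_cube_eq_iff)
  with de that show ?thesis by blast
qed

lemma coprime_prod3_eq_cube_int:
  fixes A B C s :: int
  assumes "coprime A B" "coprime A C" "coprime B C" "A * B * C = s ^ 3"
  obtains a b c where "A = a ^ 3" "B = b ^ 3" "C = c ^ 3" "s = a * b * c"
proof -
  have "coprime (A * B) C" using assms by simp
  then obtain t c where t: "A * B = t ^ 3" "C = c ^ 3" "s = t * c"
    using coprime_mult_eq_cube_int assms(4) by metis
  with assms(1) obtain a b where "A = a ^ 3" "B = b ^ 3" "t = a * b"
    using coprime_mult_eq_cube_int by metis
  with t that show ?thesis by blast
qed

lemma coprime_sum_zero:
  fixes A B C :: int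
  assumes "A + B + C = 0" "coprime A B"
  shows "coprime A C" "coprime B C"
proof -
  have C: "C = - (A + B)" using assms(1) by simp
  show "coprime A C" "coprime B C"
    using assms(2) gcd_add2[of A B] gcd_add2[of B A] unfolding C coprime_minus_right_iff
    by (simp_all add: coprime_iff_gcd_eq_1 gcd.commute add.commute)
qed

subsection \<open>The descent\<close>

text \<open>The three numbers are pairwise coprime, so each is a cube, except that for d = 3 the one
  divisible by 3 is three times a cube. Residues mod 9 then give a base divisible by 3, which takes
  the role of c.\<close>

lemma sum_zero_prod_cube_imp_cube_sum:
  fixes A B C d s :: int
  assumes sum: "A + B + C = 0" and cop: "coprime A B" and prod: "A * B * C = d * s ^ 3"
    and d: "d = 1 \<or> d = 3" and "s \<noteq> 0"
  obtains a b c where "coprime a b" "a ^ 3 + b ^ 3 + d * c ^ 3 = 0" "3 dvd c" "c dvd s" "c \<noteq> 0"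
proof -
  note result = that
  have mod9: "(x mod 9 + y mod 9 + z mod 9) mod 9 = 0" if "x + y + z = 0" for x y z :: int
    using that by (metis mod_0 mod_add_left_eq mod_add_right_eq)
  from d show ?thesis
  proof
    assume d: "d = 1"
    with prod have "A * B * C = s ^ 3" by simp
    then obtain a b c where abc: "A = a ^ 3" "B = b ^ 3" "C = c ^ 3" "s = a * b * c"
      using coprime_prod3_eq_cube_int cop coprime_sum_zero[OF sum cop] by metis
    have eq: "a ^ 3 + b ^ 3 + c ^ 3 = 0" using abc sum by simp
    then have "(a ^ 3 mod 9 + b ^ 3 mod 9 + c ^ 3 mod 9) mod 9 = 0"
      by (rule mod9[of "a ^ 3" "b ^ 3" "c ^ 3"])
    then have "3 dvd a \<or> 3 dvd b \<or> 3 dvd c"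
      using int_cube_mod_9[of a] int_cube_mod_9[of b] int_cube_mod_9[of c] by auto
    moreover have "coprime a b" "coprime a c" "coprime b c"
      using cop coprime_sum_zero[OF sum cop] by (simp_all add: abc)
    moreover have "a \<noteq> 0" "b \<noteq> 0" "c \<noteq> 0" "a dvd s" "b dvd s" "c dvd s"
      using \<open>s \<noteq> 0\<close> abc(4) by auto
    ultimately show ?thesis
      using result[of a b c] result[of a c b] result[of b c a] eq d by (auto simp: algebra_simps)
  next
    assume d: "d = 3"
    \<comment> \<open>Stated for an arbitrary triple with the multiple of 3 last, so that it serves
      whichever of A, B, C is divisible by 3.\<close>
    have *: ?thesis if 3: "3 dvd C'" and sum: "A' + B' + C' = 0" and cop: "coprime A' B'"
      and prod: "A' * B' * C' = 3 * s ^ 3" for A' B' C' :: int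
    proof -
      from 3 obtain C0 where C0: "C' = 3 * C0" ..
      have "coprime A' C0" "coprime B' C0"
        using coprime_sum_zero[OF sum cop] by (simp_all add: C0)
      moreover have "A' * B' * C0 = s ^ 3" using prod by (simp add: C0)
      ultimately obtain a b c where abc: "A' = a ^ 3" "B' = b ^ 3" "C0 = c ^ 3" "s = a * b * c"
        using coprime_prod3_eq_cube_int cop by metis
      have eq: "a ^ 3 + b ^ 3 + 3 * c ^ 3 = 0" using abc sum C0 by simp
      have "coprime a b" using cop by (simp add: abc)
      from eq have "(a ^ 3 mod 9 + b ^ 3 mod 9 + (3 * c ^ 3) mod 9) mod 9 = 0"
        by (rule mod9)
      then have "(a ^ 3 mod 9 + b ^ 3 mod 9 + 3 * (c ^ 3 mod 9) mod 9) mod 9 = 0"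
        by (simp only: mod_mult_right_eq)
      then have "3 dvd c"
        using int_cube_mod_9[of a] int_cube_mod_9[of b] int_cube_mod_9[of c] by auto
      then show ?thesis
        using result[of a b c] \<open>coprime a b\<close> eq d \<open>s \<noteq> 0\<close> abc(4) by auto
    qed
    have "3 dvd A * B * C" by (simp add: prod d)
    then have "3 dvd A \<or> 3 dvd B \<or> 3 dvd C"
      by (simp add: prime_dvd_mult_iff)
    then show ?thesis
      using *[of C A B] *[of A B C] *[of B A C] *[of A C B] *[of B C A] sum cop coprime_sum_zero[OF sum cop]
        prod d
      by (auto simp: algebra_simps)
  qed
qed

text \<open>With p + q \<omega> = (a + b \<omega>) / (1 - \<omega>) of norm N and c = -3w, the
  equation becomes q N = 3 d w^3. Here q and N are coprime and 3 does not divide N, so N is a cube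
  and q = 3 d r^3. The norm N being a cube also gives q = 3 u v (u - v). Since r divides w, r is
  smaller than c.\<close>

lemma cube_sum_descent_step:
  fixes a b c d :: int
  assumes cop: "coprime a b" and eq: "a ^ 3 + b ^ 3 + d * c ^ 3 = 0" and "3 dvd c" "c \<noteq> 0"
    and d: "d = 1 \<or> d = 3"
  obtains u v r where "coprime u v" "u * v * (u - v) = d * r ^ 3" "r \<noteq> 0" "\<bar>r\<bar> < \<bar>c\<bar>"
proof -
  \<comment> \<open>The sign is chosen so that a^3 + b^3 = 27 d w^3.\<close>
  obtain w where w: "c = 3 * (- w)" using \<open>3 dvd c\<close> by (metis dvdE minus_minus)
  have "3 dvd a + b"
  proof -
    have "(a + b) ^ 3 = a ^ 3 + b ^ 3 + 3 * (a * b * (a + b))"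
      by (simp add: power3_eq_cube algebra_simps)
    also have "\<dots> = 3 * (9 * d * w ^ 3 + a * b * (a + b))"
      using eq by (simp add: w power_mult_distrib)
    finally have "3 dvd (a + b) ^ 3" by simp
    then show ?thesis using prime_dvd_power_iff[of 3 3 "a + b"] by simp
  qed
  then obtain q where q: "a + b = 3 * q" ..
  \<comment> \<open>\<open>p + q \<omega>\<close> is \<open>(a + b \<omega>) / (1 - \<omega>)\<close>\<close>
  define p where "p = a - q"
  have ab: "a = p + q" "b = 2 * q - p" using q by (simp_all add: p_def)
  define N where "N = p\<^sup>2 - p * q + q\<^sup>2"
  have "9 * (q * N) = a ^ 3 + b ^ 3"
    by (simp add: ab N_def power2_eq_square power3_eq_cube algebra_simps)
  also have "\<dots> = 27 * (d * w ^ 3)" using eq by (simp add: w power_mult_distrib)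
  finally have qN: "q * N = 3 * d * w ^ 3" by (simp add: mult.commute)
  have pq: "coprime p q"
  proof (rule coprimeI)
    fix k assume "k dvd p" "k dvd q"
    then have "k dvd a" "k dvd b" by (simp_all add: ab)
    then show "is_unit k" using cop coprime_common_divisor by blast
  qed
  have "\<not> 3 dvd N"
  proof
    assume "3 dvd N"
    moreover have "(p + q)\<^sup>2 = N + 3 * (p * q)" by (simp add: N_def power2_eq_square algebra_simps)
    ultimately have "3 dvd a\<^sup>2" by (simp add: ab)
    then have "3 dvd a" by (simp add: prime_dvd_power_iff)
    moreover from this have "3 dvd b" using \<open>3 dvd a + b\<close> by (simp add: dvd_add_right_iff)
    ultimately show False using cop coprime_common_divisor[of a b 3] by auto
  qed
  then have "coprime 3 N" by (simp add: prime_imp_coprime)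
  then have "coprime (3 * d) N" using d by auto
  moreover have "3 * d dvd q * N" by (simp add: qN)
  ultimately have "3 * d dvd q" by (simp add: coprime_dvd_mult_left_iff)
  then obtain r0 where r0: "q = 3 * d * r0" ..
  have "coprime q N"
  proof -
    have "N = p\<^sup>2 + q * (q - p)" by (simp add: N_def power2_eq_square algebra_simps)
    then show ?thesis using pq
      by (metis coprime_commute coprime_iff_gcd_eq_1 coprime_power_right_iff gcd_add_mult mult.commute add.commute)
  qed
  then have "coprime r0 N" by (simp add: r0)
  moreover have "r0 * N = w ^ 3" using qN d by (auto simp: r0)
  ultimately obtain r t where rt: "r0 = r ^ 3" "N = t ^ 3" "w = r * t"
    using coprime_mult_eq_cube_int by metis
  obtain u v where uv: "q = 3 * u * v * (u - v)" "coprime u v"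
    using norm_form_eq_cube[OF pq, of t] rt(2) r0 by (auto simp: N_def)
  have "u * v * (u - v) = d * r ^ 3" using uv(1) r0 rt(1) by simp
  moreover have "r \<noteq> 0" "\<bar>r\<bar> < \<bar>c\<bar>"
  proof -
    have "w \<noteq> 0" using \<open>c \<noteq> 0\<close> w by simp
    then show "r \<noteq> 0" by (simp add: rt)
    have "\<bar>r\<bar> \<le> \<bar>w\<bar>" using \<open>w \<noteq> 0\<close> rt(3) dvd_imp_le_int[of w r] by simp
    then show "\<bar>r\<bar> < \<bar>c\<bar>" using \<open>w \<noteq> 0\<close> w by simp
  qed
  ultimately show ?thesis using that uv(2) by blast
qed

text \<open>Infinite descent on |s| with d fixed: a nonzero s yields c dividing s, and c yields a
  solution with 0 < |r| < |c|.\<close>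

lemma coprime_mult_diff_eq_cube:
  fixes u v d s :: int
  assumes "coprime u v" and "u * v * (u - v) = d * s ^ 3" and d: "d = 1 \<or> d = 3"
  shows "s = 0"
  using assms(1,2)
proof (induction "nat \<bar>s\<bar>" arbitrary: u v s rule: less_induct)
  case less
  show ?case
  proof (rule ccontr)
    assume "s \<noteq> 0"
    \<comment> \<open>The form u v (u - v) is rewritten as a product of three coprime numbers with
      sum zero.\<close>
    have "u + (- v) + (v - u) = 0" "coprime u (- v)" "u * (- v) * (v - u) = d * s ^ 3"
      using less.prems by (simp_all add: algebra_simps)
    then obtain a b c where abc: "coprime a b" "a ^ 3 + b ^ 3 + d * c ^ 3 = 0" "3 dvd c" "c dvd s" "c \<noteq> 0"
      using sum_zero_prod_cube_imp_cube_sum d \<open>s \<noteq> 0\<close> by metis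
    then obtain u' v' r where r: "coprime u' v'" "u' * v' * (u' - v') = d * r ^ 3" "r \<noteq> 0" "\<bar>r\<bar> < \<bar>c\<bar>"
      using cube_sum_descent_step d by metis
    have "\<bar>c\<bar> \<le> \<bar>s\<bar>" using abc(4) \<open>s \<noteq> 0\<close> by (simp add: dvd_imp_le_int)
    with r(4) have "nat \<bar>r\<bar> < nat \<bar>s\<bar>" by linarith
    then show False using less.hyps r by blast
  qed
qed

text \<open>The left side is (m + 1)^3 - m^3, so the descent applies to u = (m + 1)^3 and v = m^3
  with d = 1.\<close>

lemma diff_consecutive_cubes_eq_cube:
  fixes m c :: int
  assumes "3 * m\<^sup>2 + 3 * m + 1 = c ^ 3"
  shows "m = 0 \<or> m = - 1"
proof -
  have "coprime (m + 1) m" by simp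
  then have "coprime ((m + 1) ^ 3) (m ^ 3)" by simp
  moreover have "(m + 1) ^ 3 - m ^ 3 = c ^ 3"
    using assms by (simp add: power2_eq_square power3_eq_cube algebra_simps)
  then have "(m + 1) ^ 3 * m ^ 3 * ((m + 1) ^ 3 - m ^ 3) = 1 * ((m + 1) * m * c) ^ 3"
    by (simp add: power_mult_distrib)
  ultimately have "(m + 1) * m * c = 0" by (rule coprime_mult_diff_eq_cube) simp
  moreover have "c \<noteq> 0"
  proof
    assume "c = 0"
    with assms have "3 * (m\<^sup>2 + m) = - 1" by simp
    then show False by presburger
  qed
  ultimately show ?thesis by auto
qed

text \<open>The left side is the norm of -1 + 9 s^3 \<omega>; comparing \<omega>-coefficients gives
  3 s^3 = u v (u - v), the descent with d = 3.\<close>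

lemma nine_cube_quadratic_eq_cube:
  fixes s f :: int
  assumes "(9 * s ^ 3)\<^sup>2 + 9 * s ^ 3 + 1 = f ^ 3"
  shows "s = 0"
proof -
  obtain u v where "9 * s ^ 3 = 3 * u * v * (u - v)" "coprime u v"
    using norm_form_eq_cube[of "- 1" "9 * s ^ 3" f] assms by auto
  then show ?thesis using coprime_mult_diff_eq_cube[of u v 3 s] by simp
qed

subsection \<open>The equations\<close>

text \<open>By coprimality p divides only one factor, which therefore takes all of p^2; what remains
  is a product of coprime factors equal to a cube.\<close>

lemma coprime_mult_eq_prime_square_cube:
  fixes A B a p :: int
  assumes "prime p" "coprime A B" "A * B = p\<^sup>2 * a ^ 3"
  shows "(\<exists>c d. A = c ^ 3 \<and> B = p\<^sup>2 * d ^ 3) \<or> (\<exists>c d. A = p\<^sup>2 * c ^ 3 \<and> B = d ^ 3)"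
proof -
  have *: "\<exists>c d. X = p\<^sup>2 * c ^ 3 \<and> Y = d ^ 3"
    if "p dvd X" "coprime X Y" "X * Y = p\<^sup>2 * a ^ 3" for X Y
  proof -
    have "\<not> p dvd Y" using that(1,2) assms(1) coprime_common_divisor not_prime_unit by blast
    then have "coprime (p\<^sup>2) Y" using assms(1) by (simp add: prime_imp_coprime)
    moreover have "p\<^sup>2 dvd X * Y" using that(3) by simp
    ultimately have "p\<^sup>2 dvd X" by (simp add: coprime_dvd_mult_left_iff)
    then obtain Z where Z: "X = p\<^sup>2 * Z" ..
    have "coprime Z Y" "Z * Y = a ^ 3" using that assms(1) by (auto simp: Z)
    then show ?thesis using coprime_mult_eq_cube_int Z by metis
  qed
  have "p dvd A * B" using assms(3) by (simp add: power2_eq_square)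
  then have "p dvd A \<or> p dvd B" using assms(1) by (simp add: prime_dvd_mult_iff)
  then show ?thesis
    using *[of A B] *[of B A] assms(2,3) by (auto simp: coprime_commute mult.commute)
qed

text \<open>Excludes the degenerate cases: x^3 - 1 = -1 at x = 0, and x^3 + 1 = 2 or -7 at x = 1 or
  -2.\<close>

lemma prime_square_mult_neq:
  fixes p k n :: int
  assumes "prime p" and "n \<in> {1, 2, 7}"
  shows "p\<^sup>2 * k \<noteq> n" "p\<^sup>2 * k \<noteq> - n"
proof -
  have "\<not> p\<^sup>2 dvd n"
  proof
    assume dvd: "p\<^sup>2 dvd n"
    have "p \<ge> 2" using assms(1) by (simp add: prime_ge_2_int)
    have "p\<^sup>2 \<le> 7" using dvd assms(2) zdvd_imp_le[OF dvd] by auto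
    moreover have "p < 3"
      using power_mono[of 3 p 2] \<open>p\<^sup>2 \<le> 7\<close> by (cases "p < 3") auto
    ultimately have "p = 2" using \<open>p \<ge> 2\<close> by simp
    with dvd assms(2) show False by auto
  qed
  then show "p\<^sup>2 * k \<noteq> n" "p\<^sup>2 * k \<noteq> - n" by (metis dvd_triv_left dvd_minus_iff)+
qed

section \<open>Squeezing between consecutive cubes\<close>

lemma cubes_diff_2:
  fixes d e :: int
  assumes "e ^ 3 - d ^ 3 = 2"
  shows "d = - 1"
proof (rule ccontr)
  assume "d \<noteq> - 1"
  \<comment> \<open>Unless d = -1, e lies strictly between d and d + 2.\<close>
  have "(d + 2) ^ 3 = e ^ 3 + 6 * (d + 1)\<^sup>2"
    using assms by (simp add: power2_eq_square power3_eq_cube algebra_simps)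
  moreover have "(d + 1)\<^sup>2 > 0" using \<open>d \<noteq> - 1\<close> by simp
  ultimately have "e < d + 2" using int_cube_less_iff[of e "d + 2"] by simp
  moreover have "d < e" using assms int_cube_less_iff[of d e] by simp
  ultimately have "e = d + 1" by simp
  with assms have "3 * (d\<^sup>2 + d) = 1"
    by (simp add: power2_eq_square power3_eq_cube algebra_simps)
  then show False by presburger
qed

text \<open>The left side lies strictly between the cubes of d^2 and d^2 + 1 for d > 0, and between
  those of d^2 - 1 and d^2 for d at most -2.\<close>

lemma sextic_eq_cube:
  fixes d f :: int
  assumes "d ^ 6 + d ^ 3 + 1 = f ^ 3"
  shows "d = 0 \<or> d = - 1"
proof (rule ccontr)
  assume nd: "\<not> (d = 0 \<or> d = - 1)"
  have d6: "d ^ 6 = (d\<^sup>2) ^ 3" by (simp flip: power_mult)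
  show False
  proof (cases "d > 0")
    case True
    then have "d ^ 3 > 0" by simp
    then have "(d\<^sup>2) ^ 3 < f ^ 3" using assms d6 by linarith
    moreover have "f ^ 3 < (d\<^sup>2 + 1) ^ 3"
    proof -
      have "d * d\<^sup>2 \<le> d\<^sup>2 * d\<^sup>2" using True by (simp add: power2_eq_square)
      moreover have "d\<^sup>2 > 0" using True by simp
      moreover have "(d\<^sup>2 + 1) ^ 3 = (d\<^sup>2) ^ 3 + 3 * (d\<^sup>2 * d\<^sup>2) + 3 * d\<^sup>2 + 1"
        by (simp add: power3_eq_cube algebra_simps)
      moreover have "d ^ 3 = d * d\<^sup>2" by (simp add: power3_eq_cube power2_eq_square)
      ultimately show ?thesis using assms d6 zero_le_power2[of "d\<^sup>2"]
        unfolding power2_eq_square[of "d\<^sup>2"] by linarith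
    qed
    ultimately show False unfolding int_cube_less_iff by simp
  next
    case False
    with nd have "d \<le> - 2" by simp
    have "d ^ 3 \<le> - 8" using \<open>d \<le> - 2\<close> power_mono_odd[of 3 d "- 2"] by simp
    then have "f ^ 3 < (d\<^sup>2) ^ 3" using assms d6 by linarith
    moreover have "(d\<^sup>2 - 1) ^ 3 < f ^ 3"
    proof -
      have "(- d) * d\<^sup>2 \<le> d\<^sup>2 * d\<^sup>2"
        using \<open>d \<le> - 2\<close> mult_right_mono[of "-d" "d\<^sup>2" "d\<^sup>2"] mult_mono[of 1 "-d" "-d" "-d"]
        by (simp add: power2_eq_square)
      moreover have "d\<^sup>2 * 4 \<le> d\<^sup>2 * d\<^sup>2"
        using \<open>d \<le> - 2\<close> power_mono[of 2 "- d" 2] by (intro mult_left_mono) auto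
      moreover have "d\<^sup>2 * d\<^sup>2 > 0" using nd by simp
      moreover have "(d\<^sup>2 - 1) ^ 3 = (d\<^sup>2) ^ 3 - 3 * (d\<^sup>2 * d\<^sup>2) + 3 * d\<^sup>2 - 1"
        by (simp add: power3_eq_cube algebra_simps)
      moreover have "d ^ 3 = d * d\<^sup>2" by (simp add: power3_eq_cube power2_eq_square)
      ultimately show ?thesis using assms d6 by linarith
    qed
    ultimately show False unfolding int_cube_less_iff by simp
  qed
qed

text \<open>For x > 0 the cubes differ by only 2x, so 3 f^2 < 2x; this makes f^3 too small to be x^2
  - x + 1. Negative x follows by exchanging c and f.\<close>

lemma quadratics_not_both_cubes:
  fixes x c f :: int
  assumes c: "x\<^sup>2 + x + 1 = c ^ 3" and f: "x\<^sup>2 - x + 1 = f ^ 3"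
  shows "x = 0"
proof -
  have *: "y \<le> 0" if c: "y\<^sup>2 + y + 1 = c ^ 3" and f: "y\<^sup>2 - y + 1 = f ^ 3" for y c f :: int
  proof (rule ccontr)
    assume "\<not> y \<le> 0"
    then have y: "y \<ge> 1" by simp
    have "y * 1 \<le> y * y" using y by (intro mult_left_mono) auto
    then have "f ^ 3 > 0" unfolding f[symmetric] by (simp add: power2_eq_square)
    then have "f > 0" by simp
    have "f ^ 3 < c ^ 3" using c f y by simp
    then have "f + 1 \<le> c" by (simp add: int_cube_less_iff)
    then have "(f + 1) ^ 3 \<le> c ^ 3" by (intro power_mono_odd) auto
    moreover have "(f + 1) ^ 3 = f ^ 3 + 3 * f\<^sup>2 + 3 * f + 1"
      by (simp add: power3_eq_cube power2_eq_square algebra_simps)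
    ultimately have f2: "3 * f\<^sup>2 < 2 * y" using c f \<open>f > 0\<close> by linarith
    have "f < y"
    proof -
      have "f \<le> f\<^sup>2" using \<open>f > 0\<close> by (simp add: power2_eq_square)
      with f2 show ?thesis using y by linarith
    qed
    have "3 * f ^ 3 = 3 * f\<^sup>2 * f" by (simp add: power3_eq_cube power2_eq_square)
    also have "\<dots> < 2 * y * f" using f2 \<open>f > 0\<close> by simp
    also have "\<dots> \<le> 2 * y * (y - 1)" using \<open>f < y\<close> y by simp
    finally have "3 * (y\<^sup>2 - y + 1) < 2 * y * (y - 1)" using f by simp
    then have "y\<^sup>2 - y + 3 < 0" by (simp add: power2_eq_square algebra_simps)
    then show False using \<open>y * 1 \<le> y * y\<close> by (simp add: power2_eq_square)
  qed
  show ?thesis using *[OF c f] *[of "- x" f c] c f by simp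
qed

section \<open>The two residue classes of x modulo 3\<close>

lemma no_solution_3_dvd:
  fixes x a b p q :: int
  assumes "prime p" "prime q" and x3: "3 dvd x"
    and a: "x ^ 3 - 1 = p\<^sup>2 * a ^ 3" and b: "x ^ 3 + 1 = q\<^sup>2 * b ^ 3"
  shows False
proof -
  have x0: False if "x = 0"
    using a prime_square_mult_neq(2)[OF \<open>prime p\<close>, of 1 "a ^ 3"] that by simp
  have cop: "coprime (y - 1) (y\<^sup>2 + y + 1)" if "3 dvd y" for y :: int
  proof (rule coprimeI)
    fix k assume k: "k dvd y - 1" "k dvd y\<^sup>2 + y + 1"
    \<comment> \<open>A common divisor of the factors divides 3, hence y, hence y - (y - 1) =
      1.\<close>
    have "3 = (y\<^sup>2 + y + 1) - (y - 1) * (y + 2)" by (simp add: power2_eq_square algebra_simps)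
    then have "k dvd 3" using k by (metis dvd_diff dvd_mult2)
    then have "k dvd y" using that by (rule dvd_trans)
    then have "k dvd y - (y - 1)" using k(1) by (rule dvd_diff)
    then show "is_unit k" by simp
  qed
  have "(x - 1) * (x\<^sup>2 + x + 1) = p\<^sup>2 * a ^ 3"
    unfolding a[symmetric] by (simp add: power2_eq_square power3_eq_cube algebra_simps)
  from coprime_mult_eq_prime_square_cube[OF \<open>prime p\<close> cop[OF x3] this]
  have A: "(\<exists>c. x - 1 = c ^ 3) \<or> (\<exists>c. x\<^sup>2 + x + 1 = c ^ 3)" by blast
  have "(x + 1) * (x\<^sup>2 - x + 1) = q\<^sup>2 * b ^ 3"
    unfolding b[symmetric] by (simp add: power2_eq_square power3_eq_cube algebra_simps)
  moreover have "coprime (x + 1) (x\<^sup>2 - x + 1)"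
  proof -
    have "coprime (- (x + 1)) (x\<^sup>2 - x + 1)" using cop[of "- x"] x3 by simp
    then show ?thesis by (simp only: coprime_minus_left_iff)
  qed
  ultimately have B: "(\<exists>c. x + 1 = c ^ 3) \<or> (\<exists>c. x\<^sup>2 - x + 1 = c ^ 3)"
    using coprime_mult_eq_prime_square_cube[OF \<open>prime q\<close>] by blast
  \<comment> \<open>Substituting y = d^3 + 1 turns the quadratic into the sextic above; its root d =
    0 would give y = 1, not a multiple of 3.\<close>
  have mixed: "y = 0" if "3 dvd y" "y - 1 = d ^ 3" "y\<^sup>2 - y + 1 = f ^ 3" for y d f :: int
  proof -
    have y: "y = d ^ 3 + 1" using that(2) by simp
    have "d ^ 6 + d ^ 3 + 1 = f ^ 3"
      using that(3) by (simp add: y power2_eq_square algebra_simps flip: power_add)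
    then have "d = 0 \<or> d = - 1" by (rule sextic_eq_cube)
    then show ?thesis using that(1) y by auto
  qed
  from A B consider c d where "x - 1 = c ^ 3" "x + 1 = d ^ 3"
    | c d where "x - 1 = c ^ 3" "x\<^sup>2 - x + 1 = d ^ 3"
    | c d where "x\<^sup>2 + x + 1 = c ^ 3" "x + 1 = d ^ 3"
    | c d where "x\<^sup>2 + x + 1 = c ^ 3" "x\<^sup>2 - x + 1 = d ^ 3"
    by blast
  then show False
  proof cases
    case (1 c d)
    then have "c = - 1" using cubes_diff_2[of d c] by simp
    with 1 x0 show False by simp
  next
    case 2
    with x0 x3 mixed show False by blast
  next
    case (3 c d)
    then have "- x = 0" using mixed[of "- x" "- d" c] x3 by simp
    with x0 show False by simp
  next
    case 4
    with x0 quadratics_not_both_cubes show False by blast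
  qed
qed

text \<open>Here x^3 - 1 = 9 m (3 m^2 + 3 m + 1) with coprime cofactors, the second never a cube. If
  p = 3 the 9 cancels against p^2 and both cofactors would be cubes. Otherwise 3 divides a, hence m,
  and m/3 must be a cube s^3, so x = 9 s^3 + 1; the factors of x^3 + 1 rule this out.\<close>

lemma no_solution_cong_1:
  fixes x a b p q :: int
  assumes "prime p" "prime q" and "x mod 3 = 1"
    and a: "x ^ 3 - 1 = p\<^sup>2 * a ^ 3" and b: "x ^ 3 + 1 = q\<^sup>2 * b ^ 3"
  shows False
proof -
  define m where "m = x div 3"
  have x: "x = 3 * m + 1" using \<open>x mod 3 = 1\<close> by (simp add: m_def) (metis mult_div_mod_eq)
  have not_cube: "3 * m\<^sup>2 + 3 * m + 1 \<noteq> c ^ 3" for c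
  proof
    assume "3 * m\<^sup>2 + 3 * m + 1 = c ^ 3"
    then have "m = 0 \<or> m = - 1" by (rule diff_consecutive_cubes_eq_cube)
    then have "q\<^sup>2 * b ^ 3 = 2 \<or> q\<^sup>2 * b ^ 3 = - 7" using b x by auto
    then show False
      using prime_square_mult_neq[OF \<open>prime q\<close>, of 2 "b ^ 3"]
        prime_square_mult_neq[OF \<open>prime q\<close>, of 7 "b ^ 3"] by auto
  qed
  have cop: "coprime k (3 * m\<^sup>2 + 3 * m + 1)" if "k dvd 3 * m" for k
  proof -
    have "3 * m\<^sup>2 + 3 * m + 1 = 3 * m * (m + 1) + 1" by (simp add: power2_eq_square algebra_simps)
    then have "coprime (3 * m) (3 * m\<^sup>2 + 3 * m + 1)"
      by (metis coprime_iff_gcd_eq_1 gcd_add_mult gcd_1_int mult.commute add.commute coprime_1_right)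
    then show ?thesis using that coprime_divisors dvd_refl by blast
  qed
  have m: "9 * (m * (3 * m\<^sup>2 + 3 * m + 1)) = p\<^sup>2 * a ^ 3"
    unfolding a[symmetric] x by (simp add: power2_eq_square power3_eq_cube algebra_simps)
  show False
  proof (cases "p = 3")
    case True
    with m have "m * (3 * m\<^sup>2 + 3 * m + 1) = a ^ 3" by simp
    then show False
      using not_cube coprime_mult_eq_cube_int[OF cop[of m]] by (metis dvd_triv_right)
  next
    case False
    have "3 dvd p\<^sup>2 * a ^ 3" unfolding m[symmetric] by simp
    moreover have "\<not> 3 dvd p" using False \<open>prime p\<close> primes_dvd_imp_eq[of 3 p] by auto
    ultimately have "3 dvd a" by (simp add: prime_dvd_mult_iff prime_dvd_power_iff)
    then obtain a' where a': "a = 3 * a'" ..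
    with m have m': "m * (3 * m\<^sup>2 + 3 * m + 1) = 3 * (p\<^sup>2 * a' ^ 3)"
      by (simp add: power_mult_distrib)
    then have "3 dvd m * (3 * m\<^sup>2 + 3 * m + 1)" by simp
    then have "3 dvd m" using cop[of 3] by (simp add: coprime_dvd_mult_left_iff)
    then obtain n where n: "m = 3 * n" ..
    have "n * (3 * m\<^sup>2 + 3 * m + 1) = p\<^sup>2 * a' ^ 3" using m' n by simp
    moreover have "coprime n (3 * m\<^sup>2 + 3 * m + 1)" by (rule cop) (simp add: n)
    ultimately obtain s where s: "n = s ^ 3"
      using coprime_mult_eq_prime_square_cube[OF \<open>prime p\<close>] not_cube by metis
    have x': "x = 9 * s ^ 3 + 1" by (simp add: x n s)
    have "coprime (x + 1) (x\<^sup>2 - x + 1)"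
    proof (rule coprimeI)
      fix k assume k: "k dvd x + 1" "k dvd x\<^sup>2 - x + 1"
      have "3 = (x\<^sup>2 - x + 1) - (x + 1) * (x - 2)" by (simp add: power2_eq_square algebra_simps)
      then have "k dvd 3" using k by (metis dvd_diff dvd_mult2)
      \<comment> \<open>Since x + 1 is -1 mod 3, a common divisor of 3 and x + 1 is a unit.\<close>
      moreover have "x + 1 = 3 * (m + 1) - 1" by (simp add: x)
      ultimately show "is_unit k" using k(1)
        by (metis dvd_diff_right_iff dvd_mult2)
    qed
    moreover have "(x + 1) * (x\<^sup>2 - x + 1) = q\<^sup>2 * b ^ 3"
      unfolding b[symmetric] by (simp add: power2_eq_square power3_eq_cube algebra_simps)
    ultimately have "(\<exists>e. x + 1 = e ^ 3) \<or> (\<exists>f. x\<^sup>2 - x + 1 = f ^ 3)"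
      using coprime_mult_eq_prime_square_cube[OF \<open>prime q\<close>] by blast
    then show False
    proof
      assume "\<exists>e. x + 1 = e ^ 3"
      then obtain e where "e ^ 3 = 9 * s ^ 3 + 2" using x' by (metis add.assoc one_add_one)
      \<comment> \<open>The residue 2 is not a cube mod 9.\<close>
      then show False using int_cube_mod_9[of e] by presburger
    next
      assume "\<exists>f. x\<^sup>2 - x + 1 = f ^ 3"
      then obtain f where "x\<^sup>2 - x + 1 = f ^ 3" ..
      then have "(9 * s ^ 3)\<^sup>2 + 9 * s ^ 3 + 1 = f ^ 3"
        by (simp add: x' power2_eq_square algebra_simps)
      then have "s = 0" by (rule nine_cube_quadratic_eq_cube)
      then have "n = 0" by (simp add: s)
      \<comment> \<open>With m = 0 the second cofactor would be 1, a cube.\<close>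
      then show False using not_cube[of 1] n by simp
    qed
  qed
qed

theorem theorem1:
  shows "\<not> (\<exists>(a::int) (b::int) (x::int) (p::int) (q::int).
            prime p \<and> prime q \<and>
            x ^ 3 - 1 = p ^ 2 * a ^ 3 \<and> x ^ 3 + 1 = q ^ 2 * b ^ 3)"
proof safe
  fix a b x p q :: int
  assume p: "prime p" and q: "prime q"
    and a: "x ^ 3 - 1 = p ^ 2 * a ^ 3" and b: "x ^ 3 + 1 = q ^ 2 * b ^ 3"
  have neg: "(- x) ^ 3 - 1 = q\<^sup>2 * (- b) ^ 3" "(- x) ^ 3 + 1 = p\<^sup>2 * (- a) ^ 3"
    using a b by simp_all
  have "3 dvd x \<or> x mod 3 = 1 \<or> (- x) mod 3 = 1" by presburger
  then show False
    using no_solution_3_dvd[OF p q _ a b] no_solution_cong_1[OF p q _ a b]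
      no_solution_cong_1[OF q p _ neg] by blast
qed

end
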